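(* Let $(V,g)$ be a Euclidean real vector space of dimension $n$, and let $p,q,l\ge 0$ be integers with $p+q+l<n+1$. Then the multiplication map $D^{p,q}\to D^{p+l,q+l}$, $\omega\mapsto g^l\omega$, is injective.
   Context: $D^{p,q}=\Lambda^pV^*\otimes\Lambda^qV^*$ is the space of double forms of bidegree $(p,q)$; the product on $\bigoplus_{p,q}D^{p,q}$ is $(\theta_1\otimes\theta_2)\cdot(\theta_3\otimes\theta_4)=(\theta_1\wedge\theta_3)\otimes(\theta_2\wedge\theta_4)$. The inner product $g$ is regarded as an element of $D^{1,1}$, i.e. $g=\sum_{i=1}^n e_i\otimes e_i$ for an orthonormal basis $(e_i)$ of $V^*$, and $g^l$ is its $l$-th power in this algebra. *)

theory Defs
  imports "HOL-Analysis.Analysis" "HOL-Combinatorics.Permutations"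
begin

text \<open>
  A \<open>p\<close>-form on \<open>'a\<close> is a function of a sequence of vectors that only looks at the entries
  with index below \<open>p\<close>; the first condition makes two \<open>p\<close>-forms equal as functions exactly
  when they agree on all \<open>p\<close>-tuples. \<open>0\<close>-forms are the constants.
\<close>

definition alternating_forms :: "nat \<Rightarrow> ((nat \<Rightarrow> 'a::real_vector) \<Rightarrow> real) set" where
  "alternating_forms p = {\<alpha>.
     (\<forall>x y. (\<forall>i<p. x i = y i) \<longrightarrow> \<alpha> x = \<alpha> y) \<and>
     (\<forall>i<p. \<forall>x. linear (\<lambda>v. \<alpha> (x(i := v)))) \<and>
     (\<forall>x. \<forall>i<p. \<forall>j<p. i \<noteq> j \<longrightarrow> x i = x j \<longrightarrow> \<alpha> x = 0)}"

text \<open>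
  Exterior product of a \<open>p\<close>-form and a \<open>q\<close>-form, normalised so that
  \<open>(\<alpha> \<and> \<beta>)(u, v) = \<alpha> u * \<beta> v - \<alpha> v * \<beta> u\<close> for \<open>1\<close>-forms.
\<close>

definition wedge :: "nat \<Rightarrow> nat \<Rightarrow> ((nat \<Rightarrow> 'a) \<Rightarrow> real) \<Rightarrow> ((nat \<Rightarrow> 'a) \<Rightarrow> real) \<Rightarrow>
    (nat \<Rightarrow> 'a) \<Rightarrow> real" where
  "wedge p q \<alpha> \<beta> x =
     (\<Sum>\<sigma> | \<sigma> permutes {..<p + q}.
        of_int (sign \<sigma>) * \<alpha> (\<lambda>i. x (\<sigma> i)) * \<beta> (\<lambda>i. x (\<sigma> (p + i)))) / (fact p * fact q)"

type_synonym 'a double_form = "(nat \<Rightarrow> 'a) \<Rightarrow> (nat \<Rightarrow> 'a) \<Rightarrow> real"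

definition tensor :: "((nat \<Rightarrow> 'a) \<Rightarrow> real) \<Rightarrow> ((nat \<Rightarrow> 'a) \<Rightarrow> real) \<Rightarrow> 'a double_form" where
  "tensor \<alpha> \<beta> = (\<lambda>x y. \<alpha> x * \<beta> y)"

text \<open>
  The tensor product of the spaces of \<open>p\<close>-forms and \<open>q\<close>-forms, realised by functions of two
  groups of arguments: its elements are the finite sums of decomposable tensors.
\<close>

definition double_forms :: "nat \<Rightarrow> nat \<Rightarrow> 'a::real_vector double_form set" where
  "double_forms p q = {\<lambda>x y. \<Sum>k<m. tensor (\<alpha> k) (\<beta> k) x y | (m::nat) \<alpha> \<beta>.
     \<forall>k<m. \<alpha> k \<in> alternating_forms p \<and> \<beta> k \<in> alternating_forms q}"

text \<open>
  The product of forms of bidegrees \<open>(p, q)\<close> and \<open>(r, s)\<close>. It is the bilinear extension of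
  \<open>(\<theta>\<^sub>1 \<otimes> \<theta>\<^sub>2) \<cdot> (\<theta>\<^sub>3 \<otimes> \<theta>\<^sub>4) = (\<theta>\<^sub>1 \<and> \<theta>\<^sub>3) \<otimes> (\<theta>\<^sub>2 \<and> \<theta>\<^sub>4)\<close>;
  see the lemmas \<open>double_mult_tensor\<close>, \<open>double_mult_sum_left\<close> and \<open>double_mult_sum_right\<close>.
\<close>

definition double_mult :: "nat \<Rightarrow> nat \<Rightarrow> nat \<Rightarrow> nat \<Rightarrow>
    'a double_form \<Rightarrow> 'a double_form \<Rightarrow> 'a double_form" where
  "double_mult p q r s \<omega> \<eta> x y =
     (\<Sum>\<sigma> | \<sigma> permutes {..<p + r}. \<Sum>\<tau> | \<tau> permutes {..<q + s}.
        of_int (sign \<sigma>) * of_int (sign \<tau>) *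
        \<omega> (\<lambda>i. x (\<sigma> i)) (\<lambda>i. y (\<tau> i)) *
        \<eta> (\<lambda>i. x (\<sigma> (p + i))) (\<lambda>i. y (\<tau> (q + i)))) /
     (fact p * fact r * fact q * fact s)"

lemma double_mult_tensor:
  "double_mult p q r s (tensor \<theta>1 \<theta>2) (tensor \<theta>3 \<theta>4) =
     tensor (wedge p r \<theta>1 \<theta>3) (wedge q s \<theta>2 \<theta>4)"
  by (intro ext)
    (simp add: double_mult_def tensor_def wedge_def sum_product mult_ac times_divide_times_eq)

lemma double_mult_sum_left:
  "double_mult p q r s (\<lambda>x y. \<Sum>k\<in>K. c k * \<omega> k x y) \<eta> =
     (\<lambda>x y. \<Sum>k\<in>K. c k * double_mult p q r s (\<omega> k) \<eta> x y)"
proof (intro ext)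
  fix x y
  show "double_mult p q r s (\<lambda>x y. \<Sum>k\<in>K. c k * \<omega> k x y) \<eta> x y =
     (\<Sum>k\<in>K. c k * double_mult p q r s (\<omega> k) \<eta> x y)"
    unfolding double_mult_def times_divide_eq_right sum_divide_distrib[symmetric]
      sum_distrib_left sum_distrib_right
    by (subst (2) sum.swap, subst (3) sum.swap) (simp add: mult_ac)
qed

lemma double_mult_sum_right:
  "double_mult p q r s \<omega> (\<lambda>x y. \<Sum>k\<in>K. c k * \<eta> k x y) =
     (\<lambda>x y. \<Sum>k\<in>K. c k * double_mult p q r s \<omega> (\<eta> k) x y)"
proof (intro ext)
  fix x y
  show "double_mult p q r s \<omega> (\<lambda>x y. \<Sum>k\<in>K. c k * \<eta> k x y) x y =
     (\<Sum>k\<in>K. c k * double_mult p q r s \<omega> (\<eta> k) x y)"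
    unfolding double_mult_def times_divide_eq_right sum_divide_distrib[symmetric]
      sum_distrib_left sum_distrib_right
    by (subst (2) sum.swap, subst (3) sum.swap) (simp add: mult_ac)
qed

lemma wedge_alternating:
  assumes \<alpha>: "\<alpha> \<in> alternating_forms p" and \<beta>: "\<beta> \<in> alternating_forms q"
  shows "wedge p q \<alpha> \<beta> \<in> alternating_forms (p + q)"
proof -
  have \<alpha>_cong: "\<alpha> x = \<alpha> y" if "\<And>i. i < p \<Longrightarrow> x i = y i" for x y
    by (rule \<alpha>[unfolded alternating_forms_def mem_Collect_eq, THEN conjunct1, rule_format]) (use that in auto)
  have \<beta>_cong: "\<beta> x = \<beta> y" if "\<And>i. i < q \<Longrightarrow> x i = y i" for x y
    by (rule \<beta>[unfolded alternating_forms_def mem_Collect_eq, THEN conjunct1, rule_format]) (use that in auto)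
  have \<alpha>_lin: "linear (\<lambda>v. \<alpha> (x(i := v)))" if "i < p" for x i
    by (rule \<alpha>[unfolded alternating_forms_def mem_Collect_eq, THEN conjunct2, THEN conjunct1, rule_format]) (use that in auto)
  have \<beta>_lin: "linear (\<lambda>v. \<beta> (x(i := v)))" if "i < q" for x i
    by (rule \<beta>[unfolded alternating_forms_def mem_Collect_eq, THEN conjunct2, THEN conjunct1, rule_format]) (use that in auto)
  define F where "F \<sigma> x = of_int (sign \<sigma>) * \<alpha> (\<lambda>i. x (\<sigma> i)) * \<beta> (\<lambda>i. x (\<sigma> (p + i)))"
    for \<sigma> and x :: "nat \<Rightarrow> 'a"
  have wedge_F: "wedge p q \<alpha> \<beta> x = (\<Sum>\<sigma> | \<sigma> permutes {..<p + q}. F \<sigma> x) / (fact p * fact q)" for x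
    by (simp add: wedge_def F_def)
  have cong: "wedge p q \<alpha> \<beta> x = wedge p q \<alpha> \<beta> y" if xy: "\<forall>i<p + q. x i = y i" for x y
  proof -
    have "F \<sigma> x = F \<sigma> y" if "\<sigma> permutes {..<p + q}" for \<sigma>
    proof -
      have "x (\<sigma> i) = y (\<sigma> i)" if "i < p + q" for i
        using xy permutes_in_image[OF \<open>\<sigma> permutes _\<close>, of i] that by simp
      then show ?thesis
        using \<alpha>_cong[of "\<lambda>i. x (\<sigma> i)" "\<lambda>i. y (\<sigma> i)"]
          \<beta>_cong[of "\<lambda>i. x (\<sigma> (p + i))" "\<lambda>i. y (\<sigma> (p + i))"]
        by (simp add: F_def)
    qed
    then show ?thesis by (simp add: wedge_F)
  qed
  have lin: "linear (\<lambda>v. wedge p q \<alpha> \<beta> (x(i := v)))" if i: "i < p + q" for x i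
  proof -
    have "linear (\<lambda>v. F \<sigma> (x(i := v)))" if \<sigma>: "\<sigma> permutes {..<p + q}" for \<sigma>
    proof -
      obtain k where k: "\<sigma> k = i" "k < p + q"
        using permutes_image[OF \<sigma>] i by (metis imageE lessThan_iff)
      have upd: "(x(i := v)) (\<sigma> j) = ((\<lambda>j. x (\<sigma> j))(k := v)) j" for v j
        using k permutes_inj[OF \<sigma>] by (auto simp: inj_eq)
      show ?thesis
      proof (cases "k < p")
        case True
        have 1: "(\<lambda>j. (x(i := v)) (\<sigma> j)) = (\<lambda>j. x (\<sigma> j))(k := v)" for v
          by (rule ext) (rule upd)
        have 2: "(\<lambda>j. (x(i := v)) (\<sigma> (p + j))) = (\<lambda>j. x (\<sigma> (p + j)))" for v
          unfolding upd using True by auto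
        have "(\<lambda>v. F \<sigma> (x(i := v))) =
            (\<lambda>v. (of_int (sign \<sigma>) * \<beta> (\<lambda>j. x (\<sigma> (p + j)))) *\<^sub>R \<alpha> ((\<lambda>j. x (\<sigma> j))(k := v)))"
          unfolding F_def 1 2 by (simp add: mult_ac)
        then show ?thesis using linear_compose_scale_right[OF \<alpha>_lin[OF True]] by simp
      next
        case False
        have 1: "\<alpha> (\<lambda>j. (x(i := v)) (\<sigma> j)) = \<alpha> (\<lambda>j. x (\<sigma> j))" for v
          unfolding upd by (rule \<alpha>_cong) (use False in auto)
        have 2: "(\<lambda>j. (x(i := v)) (\<sigma> (p + j))) = (\<lambda>j. x (\<sigma> (p + j)))(k - p := v)" for v
          unfolding upd by (rule ext) (use False in auto)
        have "(\<lambda>v. F \<sigma> (x(i := v))) =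
            (\<lambda>v. (of_int (sign \<sigma>) * \<alpha> (\<lambda>j. x (\<sigma> j))) *\<^sub>R \<beta> ((\<lambda>j. x (\<sigma> (p + j)))(k - p := v)))"
          unfolding F_def 1 2 by (simp add: mult_ac)
        moreover have "k - p < q" using False k by linarith
        ultimately show ?thesis using linear_compose_scale_right[OF \<beta>_lin] by simp
      qed
    qed
    then have "linear (\<lambda>v. \<Sum>\<sigma> | \<sigma> permutes {..<p + q}. F \<sigma> (x(i := v)))"
      by (intro linear_compose_sum) auto
    from linear_compose_scale_right[OF this, of "1 / (fact p * fact q)"]
    show ?thesis by (simp add: wedge_F)
  qed
  have alt: "wedge p q \<alpha> \<beta> x = 0" if ij: "i < p + q" "j < p + q" "i \<noteq> j" "x i = x j" for x i j
  proof -
    let ?t = "Transposition.transpose i j"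
    have t: "?t permutes {..<p + q}"
      using ij by (simp add: permutes_swap_id)
    have xt: "x (?t k) = x k" for k
      using ij by (metis transpose_apply_first transpose_apply_second transpose_apply_other)
    have F: "F (?t \<circ> \<sigma>) x = - F \<sigma> x" if "\<sigma> permutes {..<p + q}" for \<sigma>
    proof -
      have "permutation \<sigma>" using that unfolding permutation_permutes by (meson finite_lessThan)
      then have "sign (?t \<circ> \<sigma>) = - sign \<sigma>"
        using ij by (simp add: sign_compose permutation_swap_id sign_swap_id)
      then show ?thesis by (simp add: F_def xt)
    qed
    have "(\<Sum>\<sigma> | \<sigma> permutes {..<p + q}. F \<sigma> x) = (\<Sum>\<sigma> | \<sigma> permutes {..<p + q}. F (?t \<circ> \<sigma>) x)"
      by (rule setum_permutations_compose_left[OF t])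
    also have "\<dots> = - (\<Sum>\<sigma> | \<sigma> permutes {..<p + q}. F \<sigma> x)"
      by (simp add: F sum_negf)
    finally show ?thesis by (simp add: wedge_F)
  qed
  show ?thesis
    unfolding alternating_forms_def mem_Collect_eq
    by (intro conjI allI impI) (fact cong, fact lin, fact alt)
qed

lemma double_mult_closed:
  assumes "\<omega> \<in> double_forms p q" and "\<eta> \<in> double_forms r s"
  shows "double_mult p q r s \<omega> \<eta> \<in> double_forms (p + r) (q + s)"
proof -
  obtain m :: nat and \<alpha> \<beta> where \<omega>: "\<omega> = (\<lambda>x y. \<Sum>k<m. tensor (\<alpha> k) (\<beta> k) x y)"
    and ab: "\<forall>k<m. \<alpha> k \<in> alternating_forms p \<and> \<beta> k \<in> alternating_forms q"
    using assms(1) unfolding double_forms_def by blast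
  obtain m' :: nat and \<gamma> \<delta> where \<eta>: "\<eta> = (\<lambda>x y. \<Sum>k<m'. tensor (\<gamma> k) (\<delta> k) x y)"
    and cd: "\<forall>k<m'. \<gamma> k \<in> alternating_forms r \<and> \<delta> k \<in> alternating_forms s"
    using assms(2) unfolding double_forms_def by blast
  define A where "A j = wedge p r (\<alpha> (j div m')) (\<gamma> (j mod m'))" for j
  define B where "B j = wedge q s (\<beta> (j div m')) (\<delta> (j mod m'))" for j
  have idx: "a * m' + b < m * m'" if "a < m" "b < m'" for a b
    using that mult_le_mono1[of "Suc a" m m'] by simp
  have mod_less: "j mod m' < m'" if "j < m * m'" for j
    using that by (cases m') auto
  have "double_mult p q r s \<omega> \<eta> = (\<lambda>x y. \<Sum>k<m. \<Sum>l<m'.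
      tensor (wedge p r (\<alpha> k) (\<gamma> l)) (wedge q s (\<beta> k) (\<delta> l)) x y)"
    unfolding \<omega> \<eta>
      double_mult_sum_left[where c = "\<lambda>_. 1", unfolded mult_1_left]
      double_mult_sum_right[where c = "\<lambda>_. 1", unfolded mult_1_left]
      double_mult_tensor ..
  also have "\<dots> = (\<lambda>x y. \<Sum>j<m * m'. tensor (A j) (B j) x y)"
  proof (intro ext)
    fix x y
    show "(\<Sum>k<m. \<Sum>l<m'. tensor (wedge p r (\<alpha> k) (\<gamma> l)) (wedge q s (\<beta> k) (\<delta> l)) x y) =
        (\<Sum>j<m * m'. tensor (A j) (B j) x y)"
      unfolding sum.cartesian_product
      by (rule sum.reindex_bij_witness[where j = "\<lambda>(k, l). k * m' + l"
            and i = "\<lambda>j. (j div m', j mod m')"])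
        (auto simp: A_def B_def less_mult_imp_div_less idx mod_less)
  qed
  finally have eq: "double_mult p q r s \<omega> \<eta> = (\<lambda>x y. \<Sum>j<m * m'. tensor (A j) (B j) x y)" .
  have "A j \<in> alternating_forms (p + r) \<and> B j \<in> alternating_forms (q + s)" if "j < m * m'" for j
  proof -
    have "m' > 0" using that by (cases m') auto
    with that have "j div m' < m" "j mod m' < m'"
      by (auto simp: less_mult_imp_div_less)
    then show ?thesis using ab cd by (simp add: A_def B_def wedge_alternating)
  qed
  then show ?thesis unfolding eq double_forms_def by blast
qed

definition metric_form :: "'a::real_inner double_form" where
  "metric_form = (\<lambda>x y. x 0 \<bullet> y 0)"

lemma metric_orthonormal_basis:
  fixes E :: "'a::real_inner set"
  assumes "finite E" and "span E = UNIV" and "pairwise orthogonal E" and "\<forall>e\<in>E. norm e = 1"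
  shows "metric_form = (\<lambda>x y. \<Sum>e\<in>E. tensor (\<lambda>x. e \<bullet> x 0) (\<lambda>x. e \<bullet> x 0) x y)"
proof (intro ext)
  fix x y :: "nat \<Rightarrow> 'a"
  have "u = (\<Sum>e\<in>E. (e \<bullet> u) *\<^sub>R e)" for u
  proof -
    let ?w = "u - (\<Sum>e\<in>E. (e \<bullet> u) *\<^sub>R e)"
    have "orthogonal ?w e" if "e \<in> E" for e
    proof -
      have "(\<Sum>d\<in>E. (d \<bullet> u) * (d \<bullet> e)) = (\<Sum>d\<in>E. if d = e then e \<bullet> u else 0)"
        using assms that
        by (intro sum.cong) (auto simp: pairwise_def orthogonal_def norm_eq_1)
      also have "\<dots> = e \<bullet> u" using assms(1) that by simp
      finally have "?w \<bullet> e = u \<bullet> e - e \<bullet> u"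
        by (simp add: inner_diff_left inner_sum_left)
      then show ?thesis by (simp add: orthogonal_def inner_commute)
    qed
    then have "orthogonal ?w ?w"
      using orthogonal_to_span[of ?w E ?w] assms(2) by auto
    then show ?thesis by (simp add: orthogonal_def)
  qed
  then have "x 0 \<bullet> y 0 = (\<Sum>e\<in>E. (e \<bullet> x 0) *\<^sub>R e) \<bullet> y 0" by metis
  then show "metric_form x y = (\<Sum>e\<in>E. tensor (\<lambda>x. e \<bullet> x 0) (\<lambda>x. e \<bullet> x 0) x y)"
    by (simp add: metric_form_def tensor_def inner_sum_left)
qed

lemma metric_in_double_forms:
  fixes B :: "'a::real_inner set"
  assumes B: "finite B" "span B = UNIV"
  shows "(metric_form :: 'a double_form) \<in> double_forms 1 1"
proof -
  obtain C where C: "finite C" "span C = span B" "pairwise orthogonal C"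
    using basis_orthogonal[OF B(1)] by blast
  define E where "E = (\<lambda>e. e /\<^sub>R norm e) ` (C - {0})"
  have span: "span E = UNIV"
  proof -
    have "c \<in> span E" if "c \<in> C" for c
    proof (cases "c = 0")
      case False
      then have "c /\<^sub>R norm c \<in> span E" using that by (auto simp: E_def intro: span_base)
      from span_scale[OF this, of "norm c"] show ?thesis using False by simp
    qed (simp add: span_zero)
    then have "span C \<subseteq> span E" by (intro span_minimal) auto
    then show ?thesis using C B by auto
  qed
  have orth: "pairwise orthogonal E"
    using C(3) by (auto simp: E_def pairwise_def orthogonal_def)
  have norm: "\<forall>e\<in>E. norm e = 1" by (auto simp: E_def)
  have "finite E" using C(1) by (simp add: E_def)
  note eq = metric_orthonormal_basis[OF this span orth norm]
  from \<open>finite E\<close> obtain h where "bij_betw h {..<card E} E"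
    using ex_bij_betw_nat_finite lessThan_atLeast0 by metis
  then have "(metric_form :: 'a double_form) =
      (\<lambda>x y. \<Sum>k<card E. tensor (\<lambda>x. h k \<bullet> x 0) (\<lambda>x. h k \<bullet> x 0) x y)"
    unfolding eq by (intro ext sum.reindex_bij_betw[symmetric])
  moreover have "(\<lambda>x. e \<bullet> x 0) \<in> alternating_forms 1" for e :: 'a
    by (auto simp: alternating_forms_def intro!: linearI inner_add_right)
  ultimately show ?thesis
    unfolding double_forms_def mem_Collect_eq
    by (intro exI[of _ "card E"] exI[of _ "\<lambda>k x. h k \<bullet> x 0"]) simp
qed

text \<open>The power of bidegree \<open>(0, 0)\<close> is the unit, i.e. the constant \<open>1\<close>.\<close>

fun metric_power :: "nat \<Rightarrow> 'a::real_inner double_form" where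
  "metric_power 0 = (\<lambda>x y. 1)"
| "metric_power (Suc l) = double_mult 1 1 l l metric_form (metric_power l)"

lemma metric_power_mult_closed:
  fixes B :: "'a::real_inner set"
  assumes B: "finite B" "span B = UNIV" and "\<omega> \<in> (double_forms p q :: 'a double_form set)"
  shows "double_mult l l p q (metric_power l) \<omega> \<in> double_forms (p + l) (q + l)"
proof -
  have "(metric_power l :: 'a double_form) \<in> double_forms l l"
  proof (induction l)
    case 0
    have "(\<lambda>x. 1) \<in> (alternating_forms 0 :: ((nat \<Rightarrow> 'a) \<Rightarrow> real) set)"
      by (simp add: alternating_forms_def)
    moreover have "(metric_power 0 :: 'a double_form) =
        (\<lambda>x y. \<Sum>k<Suc 0. tensor (\<lambda>x. 1) (\<lambda>x. 1) x y)"
      by (simp add: tensor_def)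
    ultimately show ?case unfolding double_forms_def
      by (intro CollectI exI[of _ "Suc 0"] exI[of _ "\<lambda>_ _. 1"]) simp
  next
    case (Suc l)
    then show ?case
      using double_mult_closed[OF metric_in_double_forms[OF B] Suc] by simp
  qed
  from double_mult_closed[OF this assms(3)] show ?thesis by (simp add: add.commute)
qed

end

theory Submission
  imports Defs
begin

text \<open>
  Let \<open>L\<close> be multiplication by \<open>g\<close> and \<open>\<Lambda>\<close> the contraction over an orthonormal basis,
  with \<open>\<Lambda> = 0\<close> if \<open>p = 0\<close> or \<open>q = 0\<close>. On double forms of bidegree \<open>(p, q)\<close> one has \<open>\<Lambda>L - L\<Lambda> = n - p - q\<close>, hence
  \<open>\<Lambda>L\<^sup>m\<^sup>+\<^sup>1 - L\<^sup>m\<^sup>+\<^sup>1\<Lambda> = (m + 1)(n - p - q - m) L\<^sup>m\<close>, and the factor is positive if \<open>p + q + m < n\<close>.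
  If \<open>L\<^sup>m\<^sup>+\<^sup>1\<omega> = 0\<close>, this gives \<open>L\<^sup>m\<^sup>+\<^sup>1\<Lambda>\<omega> = - c L\<^sup>m\<omega>\<close> with \<open>c > 0\<close>; applying \<open>L\<close> once more yields
  \<open>L\<^sup>m\<^sup>+\<^sup>2\<Lambda>\<omega> = 0\<close>, so \<open>\<Lambda>\<omega> = 0\<close> by induction on the bidegree, then \<open>L\<^sup>m\<omega> = 0\<close>, and \<open>\<omega> = 0\<close> by
  induction on the exponent.
\<close>

section \<open>Signed sums over permutations and associativity of the product\<close>

text \<open>For fixed \<open>\<rho>\<close>, the reindexing of \<open>\<sigma>\<close> by right
  translation with \<open>h \<rho>\<close> absorbs the inner sign, so all \<open>card R\<close>
  inner terms contribute equally. With \<open>R\<close> a symmetric group this produces the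
  factorial that cancels in an iterated product.\<close>

lemma sum_sign_absorb:
  fixes f :: "('b \<Rightarrow> 'b) \<Rightarrow> real"
  assumes S: "finite S" and h: "\<And>\<rho>. \<rho> \<in> R \<Longrightarrow> h \<rho> permutes S"
  shows "(\<Sum>\<sigma> | \<sigma> permutes S. of_int (sign \<sigma>) * (\<Sum>\<rho>\<in>R. of_int (sign (h \<rho>)) * f (\<sigma> \<circ> h \<rho>))) =
    of_nat (card R) * (\<Sum>\<sigma> | \<sigma> permutes S. of_int (sign \<sigma>) * f \<sigma>)"
proof -
  have "(\<Sum>\<sigma> | \<sigma> permutes S. of_int (sign \<sigma>) * (of_int (sign (h \<rho>)) * f (\<sigma> \<circ> h \<rho>))) =
      (\<Sum>\<sigma> | \<sigma> permutes S. of_int (sign \<sigma>) * f \<sigma>)" if "\<rho> \<in> R" for \<rho>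
  proof -
    have "sign (\<sigma> \<circ> h \<rho>) = sign \<sigma> * sign (h \<rho>)" if "\<sigma> permutes S" for \<sigma>
      by (intro sign_compose; use that h[OF \<open>\<rho> \<in> R\<close>] S permutation_permutes in blast)
    then show ?thesis
      by (subst (2) sum_permutations_compose_right[OF h[OF that]])
        (simp add: mult.assoc)
  qed
  then show ?thesis
    by (simp add: sum_distrib_left sum.swap[of _ R])
qed

lemma sum_sign_absorb2:
  fixes F :: "('b \<Rightarrow> 'b) \<Rightarrow> ('c \<Rightarrow> 'c) \<Rightarrow> real"
  assumes S: "finite S" and h: "\<And>\<rho>. \<rho> \<in> R \<Longrightarrow> h \<rho> permutes S"
    and T: "finite T" and k: "\<And>\<kappa>. \<kappa> \<in> K \<Longrightarrow> k \<kappa> permutes T"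
  shows "(\<Sum>\<sigma> | \<sigma> permutes S. \<Sum>\<tau> | \<tau> permutes T. of_int (sign \<sigma>) * of_int (sign \<tau>) *
      (\<Sum>\<rho>\<in>R. \<Sum>\<kappa>\<in>K. of_int (sign (h \<rho>)) * of_int (sign (k \<kappa>)) * F (\<sigma> \<circ> h \<rho>) (\<tau> \<circ> k \<kappa>))) =
    of_nat (card R) * of_nat (card K) *
      (\<Sum>\<sigma> | \<sigma> permutes S. \<Sum>\<tau> | \<tau> permutes T. of_int (sign \<sigma>) * of_int (sign \<tau>) * F \<sigma> \<tau>)"
    (is "?lhs = ?rhs")
proof -
  \<comment> \<open>Absorbing \<open>\<kappa>\<close> first turns the \<open>\<tau>\<close>-part
    into a function of \<open>s\<close> alone, which leaves a one-variable sum in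
    \<open>\<sigma>\<close>.\<close>
  define G where "G s = of_nat (card K) * (\<Sum>\<tau> | \<tau> permutes T. of_int (sign \<tau>) * F s \<tau>)" for s
  have "(\<Sum>\<tau> | \<tau> permutes T. of_int (sign \<sigma>) * of_int (sign \<tau>) *
      (\<Sum>\<rho>\<in>R. \<Sum>\<kappa>\<in>K. of_int (sign (h \<rho>)) * of_int (sign (k \<kappa>)) * F (\<sigma> \<circ> h \<rho>) (\<tau> \<circ> k \<kappa>))) =
    of_int (sign \<sigma>) * (\<Sum>\<rho>\<in>R. of_int (sign (h \<rho>)) * G (\<sigma> \<circ> h \<rho>))" for \<sigma>
  proof -
    have G: "G s = (\<Sum>\<tau> | \<tau> permutes T. of_int (sign \<tau>) *
        (\<Sum>\<kappa>\<in>K. of_int (sign (k \<kappa>)) * F s (\<tau> \<circ> k \<kappa>)))" for s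
      unfolding G_def by (rule sum_sign_absorb[OF T, symmetric]) (rule k)
    have "of_int (sign (h \<rho>)) * G (\<sigma> \<circ> h \<rho>) = (\<Sum>\<tau> | \<tau> permutes T. \<Sum>\<kappa>\<in>K.
        of_int (sign \<tau>) * (of_int (sign (h \<rho>)) * of_int (sign (k \<kappa>)) * F (\<sigma> \<circ> h \<rho>) (\<tau> \<circ> k \<kappa>)))" for \<rho>
      by (simp add: G sum_distrib_left mult_ac)
    then show ?thesis
      by (simp add: sum_distrib_left sum.swap[of _ R] mult.assoc)
  qed
  then have "?lhs = (\<Sum>\<sigma> | \<sigma> permutes S. of_int (sign \<sigma>) *
      (\<Sum>\<rho>\<in>R. of_int (sign (h \<rho>)) * G (\<sigma> \<circ> h \<rho>)))"
    by simp
  also have "\<dots> = ?rhs"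
    by (subst sum_sign_absorb[OF S]) (auto simp: h G_def sum_distrib_left mult_ac)
  finally show ?thesis .
qed

text \<open>In a product bracketed to the right, the inner permutations act on the arguments behind
  the first \<open>a\<close>; \<open>h\<close> embeds them into the permutations of all
  arguments.\<close>

lemma obtain_shift_permutation:
  fixes a n :: nat
  obtains h :: "(nat \<Rightarrow> nat) \<Rightarrow> nat \<Rightarrow> nat" where
    "\<And>\<rho>. \<rho> permutes {..<n} \<Longrightarrow> h \<rho> permutes {..<a + n}"
    "\<And>\<rho>. \<rho> permutes {..<n} \<Longrightarrow> sign (h \<rho>) = sign \<rho>"
    "\<And>\<rho> i. \<rho> permutes {..<n} \<Longrightarrow> i < a \<Longrightarrow> h \<rho> i = i"
    "\<And>\<rho> i. \<rho> permutes {..<n} \<Longrightarrow> h \<rho> (a + i) = a + \<rho> i"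
proof
  let ?h = "map_permutation {..<n} (\<lambda>i. a + i)"
  fix \<rho> assume \<rho>: "\<rho> permutes {..<n}"
  have inj: "inj_on (\<lambda>i. a + i) {..<n}" by simp
  have "?h \<rho> permutes (\<lambda>i. a + i) ` {..<n}"
    using \<rho> by (intro map_permutation_permutes inj_on_imp_bij_betw inj)
  then show "?h \<rho> permutes {..<a + n}"
    by (rule permutes_subset) auto
  show "sign (?h \<rho>) = sign \<rho>"
    by (rule sign_map_permutation[OF inj \<rho>]) simp
  show "?h \<rho> i = i" if "i < a" for i
    using that by (auto simp: map_permutation_def restrict_id_def)
  show "?h \<rho> (a + i) = a + \<rho> i" for i
  proof (cases "i < n")
    case True
    then show ?thesis by (intro map_permutation_apply) auto
  next
    case False
    then show ?thesis using permutes_not_in[OF \<rho>, of i] by (auto simp: map_permutation_def restrict_id_def)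
  qed
qed

text \<open>Both bracketings reduce to the same sum \<open>Z\<close> over permutations of all
  arguments, divided by the six factorials of the separate degrees.\<close>

lemma double_mult_assoc:
  assumes local: "\<And>x x' y y'. (\<And>i. i < p1 \<Longrightarrow> x i = x' i) \<Longrightarrow> (\<And>i. i < q1 \<Longrightarrow> y i = y' i) \<Longrightarrow> \<omega> x y = \<omega> x' y'"
  shows "double_mult (p1 + p2) (q1 + q2) p3 q3 (double_mult p1 q1 p2 q2 \<omega> \<eta>) \<zeta> =
    double_mult p1 q1 (p2 + p3) (q2 + q3) \<omega> (double_mult p2 q2 p3 q3 \<eta> \<zeta>)"
proof (intro ext)
  fix x :: "nat \<Rightarrow> 'a" and y :: "nat \<Rightarrow> 'a"
  \<comment> \<open>The unbracketed integrand: the three factors read consecutive blocks of the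
    permuted arguments.\<close>
  define T where "T \<sigma> \<tau> = \<omega> (\<lambda>i. x (\<sigma> i)) (\<lambda>i. y (\<tau> i)) *
      \<eta> (\<lambda>i. x (\<sigma> (p1 + i))) (\<lambda>i. y (\<tau> (q1 + i))) *
      \<zeta> (\<lambda>i. x (\<sigma> (p1 + p2 + i))) (\<lambda>i. y (\<tau> (q1 + q2 + i)))" for \<sigma> \<tau> :: "nat \<Rightarrow> nat"
  define P where "P n = {\<sigma>. \<sigma> permutes {..<n::nat}}" for n
  have card: "card (P n) = fact n" for n
    unfolding P_def by (rule card_permutations) auto
  define Z where "Z = (\<Sum>\<sigma> | \<sigma> permutes {..<p1 + p2 + p3}. \<Sum>\<tau> | \<tau> permutes {..<q1 + q2 + q3}.
    of_int (sign \<sigma>) * of_int (sign \<tau>) * T \<sigma> \<tau>)"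
  have "double_mult (p1 + p2) (q1 + q2) p3 q3 (double_mult p1 q1 p2 q2 \<omega> \<eta>) \<zeta> x y =
    (\<Sum>\<sigma> | \<sigma> permutes {..<p1 + p2 + p3}. \<Sum>\<tau> | \<tau> permutes {..<q1 + q2 + q3}.
      of_int (sign \<sigma>) * of_int (sign \<tau>) * (\<Sum>\<rho>\<in>P (p1 + p2). \<Sum>\<kappa>\<in>P (q1 + q2).
         of_int (sign \<rho>) * of_int (sign \<kappa>) * T (\<sigma> \<circ> \<rho>) (\<tau> \<circ> \<kappa>))) /
      (fact p1 * fact p2 * fact q1 * fact q2 * (fact (p1 + p2) * fact p3 * fact (q1 + q2) * fact q3))"
  proof -
    have "of_int (sign \<sigma>) * of_int (sign \<tau>) *
        double_mult p1 q1 p2 q2 \<omega> \<eta> (\<lambda>i. x (\<sigma> i)) (\<lambda>i. y (\<tau> i)) *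
        \<zeta> (\<lambda>i. x (\<sigma> (p1 + p2 + i))) (\<lambda>i. y (\<tau> (q1 + q2 + i))) =
      of_int (sign \<sigma>) * of_int (sign \<tau>) * (\<Sum>\<rho>\<in>P (p1 + p2). \<Sum>\<kappa>\<in>P (q1 + q2).
         of_int (sign \<rho>) * of_int (sign \<kappa>) * T (\<sigma> \<circ> \<rho>) (\<tau> \<circ> \<kappa>)) /
      (fact p1 * fact p2 * fact q1 * fact q2)" for \<sigma> \<tau>
    proof -
      have fixed: "\<rho> (m + i) = m + i" if "\<rho> \<in> P m" for \<rho> m i
        using permutes_not_in[of \<rho> "{..<m}" "m + i"] that by (auto simp: P_def)
      have "T (\<sigma> \<circ> \<rho>) (\<tau> \<circ> \<kappa>) = \<omega> (\<lambda>i. x (\<sigma> (\<rho> i))) (\<lambda>i. y (\<tau> (\<kappa> i))) *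
          \<eta> (\<lambda>i. x (\<sigma> (\<rho> (p1 + i)))) (\<lambda>i. y (\<tau> (\<kappa> (q1 + i)))) *
          \<zeta> (\<lambda>i. x (\<sigma> (p1 + p2 + i))) (\<lambda>i. y (\<tau> (q1 + q2 + i)))"
        if "\<rho> \<in> P (p1 + p2)" "\<kappa> \<in> P (q1 + q2)" for \<rho> \<kappa>
        using that by (simp add: T_def fixed)
      then show ?thesis
        by (simp add: double_mult_def P_def[symmetric] sum_distrib_left sum_distrib_right
            sum_divide_distrib mult_ac cong: sum.cong)
    qed
    then show ?thesis
      unfolding double_mult_def[of "p1 + p2"]
      by (simp only: sum_divide_distrib[symmetric] divide_divide_eq_left)
  qed
  \<comment> \<open>Absorption yields \<open>fact (p1 + p2) * fact (q1 + q2)\<close>, which cancels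
    against the outer normalisation.\<close>
  also have "\<dots> = Z / (fact p1 * fact p2 * fact p3 * fact q1 * fact q2 * fact q3)"
    by (subst sum_sign_absorb2)
      (auto simp: P_def card[unfolded P_def] Z_def intro: permutes_subset)
  finally have left: "double_mult (p1 + p2) (q1 + q2) p3 q3 (double_mult p1 q1 p2 q2 \<omega> \<eta>) \<zeta> x y =
    Z / (fact p1 * fact p2 * fact p3 * fact q1 * fact q2 * fact q3)" .
  obtain h where h: "\<And>\<rho>. \<rho> permutes {..<p2 + p3} \<Longrightarrow> h \<rho> permutes {..<p1 + (p2 + p3)}"
    "\<And>\<rho>. \<rho> permutes {..<p2 + p3} \<Longrightarrow> sign (h \<rho>) = sign \<rho>"
    "\<And>\<rho> i. \<rho> permutes {..<p2 + p3} \<Longrightarrow> i < p1 \<Longrightarrow> h \<rho> i = i"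
    "\<And>\<rho> i. \<rho> permutes {..<p2 + p3} \<Longrightarrow> h \<rho> (p1 + i) = p1 + \<rho> i"
    using obtain_shift_permutation by blast
  obtain k where k: "\<And>\<rho>. \<rho> permutes {..<q2 + q3} \<Longrightarrow> k \<rho> permutes {..<q1 + (q2 + q3)}"
    "\<And>\<rho>. \<rho> permutes {..<q2 + q3} \<Longrightarrow> sign (k \<rho>) = sign \<rho>"
    "\<And>\<rho> i. \<rho> permutes {..<q2 + q3} \<Longrightarrow> i < q1 \<Longrightarrow> k \<rho> i = i"
    "\<And>\<rho> i. \<rho> permutes {..<q2 + q3} \<Longrightarrow> k \<rho> (q1 + i) = q1 + \<rho> i"
    using obtain_shift_permutation by blast
  have "double_mult p1 q1 (p2 + p3) (q2 + q3) \<omega> (double_mult p2 q2 p3 q3 \<eta> \<zeta>) x y =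
    (\<Sum>\<sigma> | \<sigma> permutes {..<p1 + (p2 + p3)}. \<Sum>\<tau> | \<tau> permutes {..<q1 + (q2 + q3)}.
      of_int (sign \<sigma>) * of_int (sign \<tau>) * (\<Sum>\<rho>\<in>P (p2 + p3). \<Sum>\<kappa>\<in>P (q2 + q3).
         of_int (sign (h \<rho>)) * of_int (sign (k \<kappa>)) * T (\<sigma> \<circ> h \<rho>) (\<tau> \<circ> k \<kappa>))) /
      (fact p2 * fact p3 * fact q2 * fact q3 * (fact p1 * fact (p2 + p3) * fact q1 * fact (q2 + q3)))"
  proof -
    have "of_int (sign \<sigma>) * of_int (sign \<tau>) * \<omega> (\<lambda>i. x (\<sigma> i)) (\<lambda>i. y (\<tau> i)) *
        double_mult p2 q2 p3 q3 \<eta> \<zeta> (\<lambda>i. x (\<sigma> (p1 + i))) (\<lambda>i. y (\<tau> (q1 + i))) =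
      of_int (sign \<sigma>) * of_int (sign \<tau>) * (\<Sum>\<rho>\<in>P (p2 + p3). \<Sum>\<kappa>\<in>P (q2 + q3).
         of_int (sign (h \<rho>)) * of_int (sign (k \<kappa>)) * T (\<sigma> \<circ> h \<rho>) (\<tau> \<circ> k \<kappa>)) /
      (fact p2 * fact p3 * fact q2 * fact q3)" for \<sigma> \<tau>
    proof -
      have "T (\<sigma> \<circ> h \<rho>) (\<tau> \<circ> k \<kappa>) = \<omega> (\<lambda>i. x (\<sigma> i)) (\<lambda>i. y (\<tau> i)) *
          \<eta> (\<lambda>i. x (\<sigma> (p1 + \<rho> i))) (\<lambda>i. y (\<tau> (q1 + \<kappa> i))) *
          \<zeta> (\<lambda>i. x (\<sigma> (p1 + \<rho> (p2 + i)))) (\<lambda>i. y (\<tau> (q1 + \<kappa> (q2 + i))))"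
        "sign (h \<rho>) = sign \<rho>" "sign (k \<kappa>) = sign \<kappa>"
        if "\<rho> \<in> P (p2 + p3)" "\<kappa> \<in> P (q2 + q3)" for \<rho> \<kappa>
      proof -
        \<comment> \<open>\<open>h \<rho>\<close> and \<open>k \<kappa>\<close> are the identity
          only below \<open>p1\<close> and \<open>q1\<close>, so this rests on
          \<open>local\<close>.\<close>
        have "\<omega> (\<lambda>i. x (\<sigma> (h \<rho> i))) (\<lambda>i. y (\<tau> (k \<kappa> i))) = \<omega> (\<lambda>i. x (\<sigma> i)) (\<lambda>i. y (\<tau> i))"
          using that by (intro local) (auto simp: P_def h k)
        then show "T (\<sigma> \<circ> h \<rho>) (\<tau> \<circ> k \<kappa>) = \<omega> (\<lambda>i. x (\<sigma> i)) (\<lambda>i. y (\<tau> i)) *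
          \<eta> (\<lambda>i. x (\<sigma> (p1 + \<rho> i))) (\<lambda>i. y (\<tau> (q1 + \<kappa> i))) *
          \<zeta> (\<lambda>i. x (\<sigma> (p1 + \<rho> (p2 + i)))) (\<lambda>i. y (\<tau> (q1 + \<kappa> (q2 + i))))"
          using that by (simp add: T_def P_def h k add.assoc)
      qed (use that in \<open>auto simp: P_def h k\<close>)
      then show ?thesis
        by (simp add: double_mult_def P_def[symmetric] sum_distrib_left sum_distrib_right
            sum_divide_distrib mult_ac cong: sum.cong)
    qed
    then show ?thesis
      unfolding double_mult_def[of p1 q1 "p2 + p3"]
      by (simp only: sum_divide_distrib[symmetric] divide_divide_eq_left)
  qed
  also have "\<dots> = Z / (fact p1 * fact p2 * fact p3 * fact q1 * fact q2 * fact q3)"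
    by (subst sum_sign_absorb2) (auto simp: P_def h k card[unfolded P_def] Z_def add.assoc)
  finally show "double_mult (p1 + p2) (q1 + q2) p3 q3 (double_mult p1 q1 p2 q2 \<omega> \<eta>) \<zeta> x y =
      double_mult p1 q1 (p2 + p3) (q2 + q3) \<omega> (double_mult p2 q2 p3 q3 \<eta> \<zeta>) x y"
    unfolding left ..
qed

section \<open>Alternating forms under permutation of their arguments\<close>

abbreviation transp :: "'b \<Rightarrow> 'b \<Rightarrow> 'b \<Rightarrow> 'b" where
  "transp \<equiv> Transposition.transpose"

lemma alternating_forms_cong:
  assumes "\<alpha> \<in> alternating_forms p" "\<And>i. i < p \<Longrightarrow> x i = y i"
  shows "\<alpha> x = \<alpha> y"
  using assms unfolding alternating_forms_def by blast

lemma alternating_forms_linear: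
  assumes "\<alpha> \<in> alternating_forms p" "i < p"
  shows "linear (\<lambda>v. \<alpha> (x(i := v)))"
  using assms unfolding alternating_forms_def by blast

lemma alternating_forms_eq_0:
  assumes "\<alpha> \<in> alternating_forms p" "i < p" "j < p" "i \<noteq> j" "x i = x j"
  shows "\<alpha> x = 0"
  using assms unfolding alternating_forms_def by blast

lemma alternating_forms_sum:
  assumes "\<And>k. k \<in> K \<Longrightarrow> f k \<in> alternating_forms p"
  shows "(\<lambda>x. \<Sum>k\<in>K. c k * f k x) \<in> alternating_forms p"
proof -
  have "linear (\<lambda>v. \<Sum>k\<in>K. c k * f k (x(i := v)))" if "i < p" for x i
    by (intro linear_compose_sum ballI linear_compose_scale_right[where f = "\<lambda>v. f _ (x(i := v))", simplified])
      (use assms that in \<open>auto intro: alternating_forms_linear\<close>)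
  moreover have "(\<Sum>k\<in>K. c k * f k x) = (\<Sum>k\<in>K. c k * f k y)" if "\<forall>i<p. x i = y i" for x y
    using alternating_forms_cong[OF assms] that by (metis (no_types, lifting) sum.cong)
  moreover have "(\<Sum>k\<in>K. c k * f k x) = 0" if "i < p" "j < p" "i \<noteq> j" "x i = x j" for x i j
    using alternating_forms_eq_0[OF assms] that by (auto intro: sum.neutral)
  ultimately show ?thesis
    unfolding alternating_forms_def mem_Collect_eq by blast
qed

text \<open>Polarisation: expand the form with \<open>x i + x j\<close> in both slots, where it
  vanishes.\<close>

lemma alternating_forms_transpose:
  assumes \<alpha>: "\<alpha> \<in> alternating_forms p" and ij: "i < p" "j < p" "i \<noteq> j"
  shows "\<alpha> (x \<circ> transp i j) = - \<alpha> x"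
proof -
  define F where "F u v = \<alpha> (x(i := u, j := v))" for u v
  have F1: "F (u + u') v = F u v + F u' v" for u u' v
    using linear_add[OF alternating_forms_linear[OF \<alpha> ij(1)], of "x(j := v)" u u'] ij
    by (simp add: F_def fun_upd_twist)
  have F2: "F v (u + u') = F v u + F v u'" for u u' v
    using linear_add[OF alternating_forms_linear[OF \<alpha> ij(2)], of "x(i := v)" u u']
    by (simp add: F_def)
  have F0: "F u u = 0" for u
    unfolding F_def by (rule alternating_forms_eq_0[OF \<alpha> ij]) (use ij in auto)
  have "F (x i) (x j) + F (x j) (x i) = F (x i + x j) (x i + x j)"
    by (simp only: F1 F2) (simp add: F0)
  also have "\<dots> = 0" by (rule F0)
  finally have "F (x j) (x i) = - F (x i) (x j)" by linarith
  moreover have "x \<circ> transp i j = x(i := x j, j := x i)"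
    using ij by (auto simp: fun_eq_iff Transposition.transpose_def)
  ultimately show ?thesis by (simp add: F_def)
qed

lemma alternating_forms_permute:
  assumes \<alpha>: "\<alpha> \<in> alternating_forms p" and \<sigma>: "\<sigma> permutes {..<p}"
  shows "\<alpha> (x \<circ> \<sigma>) = of_int (sign \<sigma>) * \<alpha> x"
  using \<sigma> finite_lessThan[of p]
proof (induction arbitrary: x rule: permutes_induct)
  case id
  then show ?case by simp
next
  case (swap a b \<sigma>)
  have "permutation \<sigma>"
    using swap.hyps(4) by (auto simp: permutation_permutes)
  then have "sign (transp a b \<circ> \<sigma>) = - sign \<sigma>"
    using swap.hyps(3) by (simp add: sign_compose permutation_swap_id sign_swap_id)
  \<comment> \<open>The new transposition stands next to \<open>x\<close>, so the induction
    hypothesis is taken at the sequence \<open>x \<circ> transp a b\<close>.\<close>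
  moreover have "\<alpha> (x \<circ> (transp a b \<circ> \<sigma>)) = of_int (sign \<sigma>) * \<alpha> (x \<circ> transp a b)"
    using swap.IH[of "x \<circ> transp a b"] by (simp only: comp_assoc)
  moreover have "\<alpha> (x \<circ> transp a b) = - \<alpha> x"
    by (rule alternating_forms_transpose[OF \<alpha>]) (use swap.hyps in auto)
  ultimately show ?case by (simp only: of_int_minus mult_minus_left mult_minus_right)
qed

text \<open>
  \<open>case_nat v x\<close> is the sequence \<open>v, x 0, x 1, \<dots>\<close>, and \<open>\<lambda>i. x (transp 0 a (Suc i))\<close> is \<open>x\<close> with its entry
  \<open>x a\<close> removed, up to a rearrangement of sign \<open>(-1)\<^sup>a\<^sup>-\<^sup>1\<close> for \<open>a > 0\<close>. Using it instead of the
  order-preserving removal makes the sign of every term with \<open>a > 0\<close> equal to \<open>-1\<close>.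
\<close>

lemma alternating_forms_case_nat:
  assumes \<alpha>: "\<alpha> \<in> alternating_forms (Suc p)" and a: "a < Suc p"
  shows "of_int (sign (transp 0 a)) * \<alpha> (case_nat v (\<lambda>i. x (transp 0 a (Suc i)))) = \<alpha> (x(a := v))"
proof -
  have "case_nat v (\<lambda>i. x (transp 0 a (Suc i))) = x(a := v) \<circ> transp 0 a"
    by (auto simp: fun_eq_iff Transposition.transpose_def split: nat.split)
  moreover have "transp 0 a permutes {..<Suc p}"
    using a by (intro permutes_swap_id) auto
  ultimately show ?thesis
    by (simp add: alternating_forms_permute[OF \<alpha>] flip: of_int_mult mult.assoc)
qed

text \<open>Write \<open>\<sigma>\<close> as \<open>transp 0 a \<circ> \<pi>\<close> with
  \<open>a = \<sigma> 0\<close> and \<open>\<pi>\<close> fixing \<open>0\<close>. By alternation the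
  sign of \<open>\<pi>\<close> occurs twice and cancels, so the \<open>fact p\<close> choices of
  \<open>\<pi>\<close> give equal terms.\<close>

lemma alternating_forms_sum_permutes:
  assumes \<alpha>: "\<alpha> \<in> alternating_forms p"
  shows "(\<Sum>\<sigma> | \<sigma> permutes {..<Suc p}. of_int (sign \<sigma>) * (h (\<sigma> 0) * \<alpha> (\<lambda>i. x (\<sigma> (Suc i))))) =
    fact p * (\<Sum>a<Suc p. of_int (sign (transp 0 a)) * (h a * \<alpha> (\<lambda>i. x (transp 0 a (Suc i)))))"
proof -
  let ?S = "Suc ` {..<p}"
  have S: "{..<Suc p} = insert 0 ?S"
    by (rule lessThan_Suc_eq_insert_0)
  have card: "card {\<pi>. \<pi> permutes ?S} = fact p"
    by (rule card_permutations) (auto simp: card_image)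
  have "of_int (sign (transp 0 a \<circ> \<pi>)) * (h ((transp 0 a \<circ> \<pi>) 0) *
        \<alpha> (\<lambda>i. x ((transp 0 a \<circ> \<pi>) (Suc i)))) =
      of_int (sign (transp 0 a)) * (h a * \<alpha> (\<lambda>i. x (transp 0 a (Suc i))))"
    if \<pi>: "\<pi> permutes ?S" for \<pi> a
  proof -
    \<comment> \<open>\<open>\<pi>\<close> shifted down by one: the permutation it induces on the
      \<open>p\<close> arguments of \<open>\<alpha>\<close>.\<close>
    define \<rho> where "\<rho> = map_permutation ?S (\<lambda>i. i - 1) \<pi>"
    have inj: "inj_on (\<lambda>i. i - 1 :: nat) ?S" by (auto simp: inj_on_def)
    have "bij_betw (\<lambda>i. i - 1) ?S {..<p}"
      using inj by (auto simp: bij_betw_def image_image)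
    then have \<rho>: "\<rho> permutes {..<p}"
      unfolding \<rho>_def using \<pi> by (rule map_permutation_permutes)
    have "sign \<rho> = sign \<pi>"
      unfolding \<rho>_def by (rule sign_map_permutation[OF inj \<pi>]) simp
    have Suc: "\<pi> (Suc i) = Suc (\<rho> i)" for i
    proof (cases "i < p")
      case True
      then have "\<rho> (Suc i - 1) = \<pi> (Suc i) - 1"
        unfolding \<rho>_def by (intro map_permutation_apply inj) auto
      moreover have "\<pi> (Suc i) \<in> ?S"
        using True permutes_in_image[OF \<pi>] by blast
      ultimately show ?thesis by auto
    next
      case False
      then show ?thesis
        using permutes_not_in[OF \<pi>, of "Suc i"] permutes_not_in[OF \<rho>, of i] by auto
    qed
    have 0: "\<pi> 0 = 0" by (rule permutes_not_in[OF \<pi>]) auto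
    have "permutation \<pi>" using \<pi> by (auto simp: permutation_permutes)
    then have sign: "sign (transp 0 a \<circ> \<pi>) = sign (transp 0 a) * sign \<pi>"
      by (simp add: sign_compose permutation_swap_id)
    have "\<alpha> (\<lambda>i. x (transp 0 a (\<pi> (Suc i)))) = of_int (sign \<pi>) * \<alpha> (\<lambda>i. x (transp 0 a (Suc i)))"
      using alternating_forms_permute[OF \<alpha> \<rho>, of "\<lambda>i. x (transp 0 a (Suc i))"]
      unfolding comp_def Suc \<open>sign \<rho> = sign \<pi>\<close> .
    moreover have "of_int (sign \<pi>) * of_int (sign \<pi>) = (1 :: real)"
      unfolding of_int_mult[symmetric] by simp
    ultimately show ?thesis
      unfolding sign by (simp add: 0 algebra_simps)
  qed
  then show ?thesis
    unfolding S by (subst sum_over_permutations_insert)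
      (simp_all add: card flip: sum_distrib_left del: sum.insert)
qed

section \<open>Multiplication by the metric\<close>

text \<open>Contains the double forms and asks for no decomposition into tensors, so closure under
  the operators is checked in each argument group alone.\<close>

definition separately_alternating :: "nat \<Rightarrow> nat \<Rightarrow> 'a::real_vector double_form set" where
  "separately_alternating p q =
     {\<omega>. (\<forall>y. (\<lambda>x. \<omega> x y) \<in> alternating_forms p) \<and> (\<forall>x. \<omega> x \<in> alternating_forms q)}"

lemma separately_alternating_fst: "\<omega> \<in> separately_alternating p q \<Longrightarrow> (\<lambda>x. \<omega> x y) \<in> alternating_forms p"
  and separately_alternating_snd: "\<omega> \<in> separately_alternating p q \<Longrightarrow> \<omega> x \<in> alternating_forms q"
  by (auto simp: separately_alternating_def)

lemma separately_alternating_sum: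
  assumes "\<And>k. k \<in> K \<Longrightarrow> f k \<in> separately_alternating p q"
  shows "(\<lambda>x y. \<Sum>k\<in>K. c k * f k x y) \<in> separately_alternating p q"
  using assms unfolding separately_alternating_def by (auto intro!: alternating_forms_sum)

definition metric_mult :: "nat \<Rightarrow> nat \<Rightarrow> 'a::real_inner double_form \<Rightarrow> 'a double_form" where
  "metric_mult p q \<omega> = double_mult 1 1 p q metric_form \<omega>"

text \<open>Collapsing the permutation sum in each group cancels the factorials. One term remains
  for each pair \<open>a\<close>, \<open>b\<close> of arguments fed to the metric.\<close>

lemma metric_mult_eq:
  assumes \<omega>: "\<omega> \<in> separately_alternating p q"
  shows "metric_mult p q \<omega> x y = (\<Sum>a<Suc p. \<Sum>b<Suc q.
    of_int (sign (transp 0 a)) * of_int (sign (transp 0 b)) * (x a \<bullet> y b) *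
    \<omega> (\<lambda>i. x (transp 0 a (Suc i))) (\<lambda>i. y (transp 0 b (Suc i))))"
proof -
  have "metric_mult p q \<omega> x y = (\<Sum>\<sigma> | \<sigma> permutes {..<Suc p}. of_int (sign \<sigma>) *
      (\<Sum>\<tau> | \<tau> permutes {..<Suc q}. of_int (sign \<tau>) * (x (\<sigma> 0) \<bullet> y (\<tau> 0) *
        \<omega> (\<lambda>i. x (\<sigma> (Suc i))) (\<lambda>i. y (\<tau> (Suc i)))))) / (fact p * fact q)"
    by (simp add: metric_mult_def double_mult_def metric_form_def sum_distrib_left mult_ac)
  also have "\<dots> = (\<Sum>\<sigma> | \<sigma> permutes {..<Suc p}. of_int (sign \<sigma>) *
      (fact q * (\<Sum>b<Suc q. of_int (sign (transp 0 b)) * (x (\<sigma> 0) \<bullet> y b *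
        \<omega> (\<lambda>i. x (\<sigma> (Suc i))) (\<lambda>i. y (transp 0 b (Suc i))))))) / (fact p * fact q)"
    using alternating_forms_sum_permutes[OF separately_alternating_snd[OF \<omega>],
        where h = "\<lambda>b. x _ \<bullet> y b"] by simp
  also have "\<dots> = (\<Sum>b<Suc q. of_int (sign (transp 0 b)) *
      (\<Sum>\<sigma> | \<sigma> permutes {..<Suc p}. of_int (sign \<sigma>) * (x (\<sigma> 0) \<bullet> y b *
        \<omega> (\<lambda>i. x (\<sigma> (Suc i))) (\<lambda>i. y (transp 0 b (Suc i)))))) / fact p"
    by (simp only: sum_distrib_left sum_divide_distrib sum.swap[of _ _ "{..<Suc q}"])
      (simp add: mult_ac)
  also have "\<dots> = (\<Sum>b<Suc q. of_int (sign (transp 0 b)) *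
      (fact p * (\<Sum>a<Suc p. of_int (sign (transp 0 a)) * (x a \<bullet> y b *
        \<omega> (\<lambda>i. x (transp 0 a (Suc i))) (\<lambda>i. y (transp 0 b (Suc i))))))) / fact p"
    using alternating_forms_sum_permutes[OF separately_alternating_fst[OF \<omega>],
        where h = "\<lambda>a. x a \<bullet> y _"] by simp
  also have "\<dots> = (\<Sum>a<Suc p. \<Sum>b<Suc q.
      of_int (sign (transp 0 a)) * of_int (sign (transp 0 b)) * (x a \<bullet> y b) *
      \<omega> (\<lambda>i. x (transp 0 a (Suc i))) (\<lambda>i. y (transp 0 b (Suc i))))"
    by (simp only: sum_distrib_left sum_divide_distrib sum.swap[of _ _ "{..<Suc p}"])
      (simp add: mult_ac)
  finally show ?thesis .
qed

text \<open>The four groups of terms record whether \<open>u\<close> and \<open>v\<close> each go to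
  the metric or to \<open>\<omega>\<close>; each new vector going to \<open>\<omega>\<close> costs
  one transposition, hence a factor \<open>-1\<close>.\<close>

lemma metric_mult_case_nat:
  assumes \<omega>: "\<omega> \<in> separately_alternating p q"
  shows "metric_mult p q \<omega> (case_nat u x) (case_nat v y) =
    (u \<bullet> v) * \<omega> x y - (\<Sum>b<q. (u \<bullet> y b) * \<omega> x (y(b := v))) -
    (\<Sum>a<p. (x a \<bullet> v) * \<omega> (x(a := u)) y) +
    (\<Sum>a<p. \<Sum>b<q. (x a \<bullet> y b) * \<omega> (x(a := u)) (y(b := v)))"
proof -
  have upd: "(\<lambda>i. case transp 0 (Suc a) (Suc i) of 0 \<Rightarrow> w | Suc i \<Rightarrow> z i) = z(a := w)"
    for a w and z :: "nat \<Rightarrow> 'a"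
    by (auto simp: fun_eq_iff Transposition.transpose_def)
  show ?thesis
    unfolding metric_mult_eq[OF \<omega>]
    by (simp add: sum.lessThan_Suc_shift upd sign_swap_id sum_negf sum.distrib sum_subtractf del: sum.lessThan_Suc)
qed

section \<open>Contraction and its commutator with the metric\<close>

definition contraction :: "'a set \<Rightarrow> 'a double_form \<Rightarrow> 'a double_form" where
  "contraction E \<omega> x y = (\<Sum>e\<in>E. \<omega> (case_nat e x) (case_nat e y))"

lemma alternating_forms_interior:
  assumes \<alpha>: "\<alpha> \<in> alternating_forms (Suc p)"
  shows "(\<lambda>x. \<alpha> (case_nat e x)) \<in> alternating_forms p"
proof -
  have "\<alpha> (case_nat e x) = \<alpha> (case_nat e y)" if "\<forall>i<p. x i = y i" for x y
    by (rule alternating_forms_cong[OF \<alpha>]) (use that in \<open>auto split: nat.split\<close>)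
  moreover have "linear (\<lambda>v. \<alpha> (case_nat e (x(i := v))))" if "i < p" for x i
  proof -
    have "case_nat e (x(i := v)) = (case_nat e x)(Suc i := v)" for v
      by (auto simp: fun_eq_iff split: nat.split)
    then show ?thesis using alternating_forms_linear[OF \<alpha>, of "Suc i"] that by simp
  qed
  moreover have "\<alpha> (case_nat e x) = 0" if "i < p" "j < p" "i \<noteq> j" "x i = x j" for x i j
    by (rule alternating_forms_eq_0[OF \<alpha>, of "Suc i" "Suc j"]) (use that in auto)
  ultimately show ?thesis
    unfolding alternating_forms_def mem_Collect_eq by blast
qed

lemma contraction_closed:
  assumes \<omega>: "\<omega> \<in> separately_alternating (Suc p) (Suc q)"
  shows "contraction E \<omega> \<in> separately_alternating p q"
proof -
  have "(\<lambda>x y. \<omega> (case_nat e x) (case_nat e y)) \<in> separately_alternating p q" for e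
    using \<omega> unfolding separately_alternating_def
    by (auto intro: alternating_forms_interior[where \<alpha> = "\<lambda>x. \<omega> x _"] alternating_forms_interior)
  from separately_alternating_sum[where c = "\<lambda>_. 1" and K = E, OF this]
  show ?thesis by (simp add: contraction_def[abs_def])
qed

text \<open>Moving \<open>e\<close> from the front into the vacated slots \<open>a\<close> and
  \<open>b\<close> absorbs the signs. The result is the double sum that also occurs in
  \<open>contraction_metric_mult\<close>, which makes the commutator a scalar.\<close>

lemma metric_mult_contraction:
  assumes \<omega>: "\<omega> \<in> separately_alternating (Suc p) (Suc q)"
  shows "metric_mult p q (contraction E \<omega>) x y =
    (\<Sum>a<Suc p. \<Sum>b<Suc q. (x a \<bullet> y b) * (\<Sum>e\<in>E. \<omega> (x(a := e)) (y(b := e))))"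
proof -
  have "of_int (sign (transp 0 a)) * of_int (sign (transp 0 b)) *
      \<omega> (case_nat e (\<lambda>i. x (transp 0 a (Suc i)))) (case_nat e (\<lambda>i. y (transp 0 b (Suc i)))) =
      \<omega> (x(a := e)) (y(b := e))" if "a < Suc p" "b < Suc q" for a b e
    unfolding alternating_forms_case_nat[OF separately_alternating_fst[OF \<omega>] that(1), symmetric]
      alternating_forms_case_nat[OF separately_alternating_snd[OF \<omega>] that(2), symmetric]
    by (simp add: mult_ac)
  then show ?thesis
    unfolding metric_mult_eq[OF contraction_closed[OF \<omega>]] contraction_def
    by (intro sum.cong refl) (auto simp: sum_distrib_left mult_ac intro!: sum.cong)
qed

text \<open>With one group of arguments fixed, the product is a linear combination of wedges of a
  1-form with a slice of \<open>\<omega>\<close>.\<close>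

lemma metric_mult_closed:
  assumes \<omega>: "\<omega> \<in> separately_alternating p q"
  shows "metric_mult p q \<omega> \<in> separately_alternating (Suc p) (Suc q)"
proof -
  have lin: "(\<lambda>x. u \<bullet> x 0) \<in> alternating_forms 1" "(\<lambda>x. x 0 \<bullet> u) \<in> alternating_forms 1" for u :: 'a
    by (auto simp: alternating_forms_def intro!: linearI inner_add_right inner_add_left)
  have "(\<lambda>x. metric_mult p q \<omega> x y) \<in> alternating_forms (Suc p)" for y
  proof -
    \<comment> \<open>The wedge already contains the division by \<open>fact p\<close>; only
      \<open>fact q\<close> is left for the coefficients.\<close>
    have "(\<lambda>x. \<Sum>\<tau> | \<tau> permutes {..<Suc q}. (of_int (sign \<tau>) / fact q) *
        wedge 1 p (\<lambda>x. x 0 \<bullet> y (\<tau> 0)) (\<lambda>x. \<omega> x (\<lambda>i. y (\<tau> (Suc i)))) x) \<in> alternating_forms (1 + p)"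
      by (intro alternating_forms_sum wedge_alternating lin separately_alternating_fst[OF \<omega>])
    also have "(\<lambda>x. \<Sum>\<tau> | \<tau> permutes {..<Suc q}. (of_int (sign \<tau>) / fact q) *
        wedge 1 p (\<lambda>x. x 0 \<bullet> y (\<tau> 0)) (\<lambda>x. \<omega> x (\<lambda>i. y (\<tau> (Suc i)))) x) =
      (\<lambda>x. metric_mult p q \<omega> x y)"
      unfolding metric_mult_def double_mult_def
      by (subst sum.swap)
        (simp add: wedge_def metric_form_def sum_distrib_left sum_divide_distrib mult_ac)
    finally show ?thesis by simp
  qed
  moreover have "metric_mult p q \<omega> x \<in> alternating_forms (Suc q)" for x
  proof -
    have "(\<lambda>y. \<Sum>\<sigma> | \<sigma> permutes {..<Suc p}. (of_int (sign \<sigma>) / fact p) *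
        wedge 1 q (\<lambda>y. x (\<sigma> 0) \<bullet> y 0) (\<omega> (\<lambda>i. x (\<sigma> (Suc i)))) y) \<in> alternating_forms (1 + q)"
      by (intro alternating_forms_sum wedge_alternating lin separately_alternating_snd[OF \<omega>])
    also have "(\<lambda>y. \<Sum>\<sigma> | \<sigma> permutes {..<Suc p}. (of_int (sign \<sigma>) / fact p) *
        wedge 1 q (\<lambda>y. x (\<sigma> 0) \<bullet> y 0) (\<omega> (\<lambda>i. x (\<sigma> (Suc i)))) y) = metric_mult p q \<omega> x"
      unfolding metric_mult_def double_mult_def
      by (simp add: fun_eq_iff wedge_def metric_form_def sum_distrib_left sum_divide_distrib mult_ac)
    finally show ?thesis by simp
  qed
  ultimately show ?thesis by (simp add: separately_alternating_def)
qed

lemma metric_mult_add: "metric_mult p q (\<lambda>x y. c * \<omega> x y + \<eta> x y) =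
    (\<lambda>x y. c * metric_mult p q \<omega> x y + metric_mult p q \<eta> x y)"
  by (simp add: fun_eq_iff metric_mult_def double_mult_def sum.distrib sum_distrib_left
      add_divide_distrib algebra_simps)

lemma metric_mult_0: "metric_mult p q (\<lambda>x y. 0) = (\<lambda>x y. 0)"
  by (simp add: fun_eq_iff metric_mult_def double_mult_def)

lemma orthonormal_basis_exists:
  fixes B :: "'a::real_inner set"
  assumes B: "finite B" "span B = UNIV"
  obtains E :: "'a set" where "finite E" "card E = dim (UNIV :: 'a set)"
    "\<And>e. e \<in> E \<Longrightarrow> e \<bullet> e = 1" "\<And>u. (\<Sum>e\<in>E. (e \<bullet> u) *\<^sub>R e) = u"
proof -
  obtain C where C: "finite C" "span C = span B" "pairwise orthogonal C"
    using basis_orthogonal[OF B(1)] by blast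
  define E where "E = (\<lambda>e. e /\<^sub>R norm e) ` (C - {0})"
  have fin: "finite E" using C(1) by (simp add: E_def)
  have orth: "pairwise orthogonal E"
    using C(3) by (auto simp: E_def pairwise_def orthogonal_def)
  have norm: "\<forall>e\<in>E. norm e = 1" by (auto simp: E_def)
  have "c \<in> span E" if "c \<in> C" for c
  proof (cases "c = 0")
    case False
    then have "c /\<^sub>R norm c \<in> span E" using that by (auto simp: E_def intro: span_base)
    from span_scale[OF this, of "norm c"] show ?thesis using False by simp
  qed (simp add: span_zero)
  then have "span C \<subseteq> span E" by (intro span_minimal) auto
  then have span: "span E = UNIV" using C(2) B(2) by auto
  have "independent E"
    using orth norm by (intro pairwise_orthogonal_independent) auto
  then have "card E = dim (UNIV :: 'a set)"
    using span by (intro dim_eq_card[symmetric]) auto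
  moreover have "(\<Sum>e\<in>E. (e \<bullet> u) *\<^sub>R e) = u" for u
  proof -
    \<comment> \<open>The expansion of the metric, evaluated at constant sequences; testing against
      all \<open>v\<close> then determines the vector.\<close>
    have "(\<Sum>e\<in>E. (e \<bullet> u) *\<^sub>R e) \<bullet> v = u \<bullet> v" for v
      using metric_orthonormal_basis[OF fin span orth norm, THEN fun_cong, THEN fun_cong, of "\<lambda>_. u" "\<lambda>_. v"]
      by (simp add: metric_form_def tensor_def inner_sum_left)
    then show ?thesis using vector_eq_rdot by blast
  qed
  ultimately show ?thesis
    using fin norm by (intro that) (auto simp: norm_eq_1)
qed

text \<open>Set \<open>u = v = e\<close> in \<open>metric_mult_case_nat\<close> and sum. The trace
  of the metric gives \<open>card E\<close>, and each of the \<open>p + q\<close> single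
  substitutions reproduces \<open>\<omega>\<close> with a minus sign. The double sum is empty if
  \<open>p = 0\<close> or \<open>q = 0\<close>.\<close>

lemma contraction_metric_mult:
  assumes \<omega>: "\<omega> \<in> separately_alternating p q"
    and unit: "\<And>e. e \<in> E \<Longrightarrow> e \<bullet> e = 1" and basis: "\<And>u. (\<Sum>e\<in>E. (e \<bullet> u) *\<^sub>R e) = u"
  shows "contraction E (metric_mult p q \<omega>) x y =
    (of_nat (card E) - of_nat p - of_nat q) * \<omega> x y +
    (\<Sum>a<p. \<Sum>b<q. (x a \<bullet> y b) * (\<Sum>e\<in>E. \<omega> (x(a := e)) (y(b := e))))"
proof -
  \<comment> \<open>Applied to \<open>\<omega>\<close> as a function of a single slot, this undoes a
    substitution of basis vectors.\<close>
  have expand: "(\<Sum>e\<in>E. (e \<bullet> u) * f e) = f u" if "linear f" for f :: "'a \<Rightarrow> real" and u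
  proof -
    have "f u = f (\<Sum>e\<in>E. (e \<bullet> u) *\<^sub>R e)" by (simp add: basis)
    also have "\<dots> = (\<Sum>e\<in>E. (e \<bullet> u) * f e)"
      by (simp add: linear_sum[OF that] linear_cmul[OF that])
    finally show ?thesis by simp
  qed
  have "contraction E (metric_mult p q \<omega>) x y =
    (\<Sum>e\<in>E. (e \<bullet> e) * \<omega> x y) - (\<Sum>b<q. \<Sum>e\<in>E. (e \<bullet> y b) * \<omega> x (y(b := e))) -
    (\<Sum>a<p. \<Sum>e\<in>E. (e \<bullet> x a) * \<omega> (x(a := e)) y) +
    (\<Sum>a<p. \<Sum>b<q. \<Sum>e\<in>E. (x a \<bullet> y b) * \<omega> (x(a := e)) (y(b := e)))"
    unfolding contraction_def metric_mult_case_nat[OF \<omega>]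
    by (simp add: sum.distrib sum_subtractf sum.swap[of _ E] inner_commute[of "x _" e for e])
  also have "(\<Sum>e\<in>E. (e \<bullet> e) * \<omega> x y) = of_nat (card E) * \<omega> x y"
    by (simp add: unit)
  also have "(\<Sum>b<q. \<Sum>e\<in>E. (e \<bullet> y b) * \<omega> x (y(b := e))) = of_nat q * \<omega> x y"
  proof -
    have "(\<Sum>e\<in>E. (e \<bullet> y b) * \<omega> x (y(b := e))) = \<omega> x y" if "b < q" for b
      using expand[OF alternating_forms_linear[OF separately_alternating_snd[OF \<omega>] that]] by simp
    then show ?thesis by simp
  qed
  also have "(\<Sum>a<p. \<Sum>e\<in>E. (e \<bullet> x a) * \<omega> (x(a := e)) y) = of_nat p * \<omega> x y"
  proof -
    have "(\<Sum>e\<in>E. (e \<bullet> x a) * \<omega> (x(a := e)) y) = \<omega> x y" if "a < p" for a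
      using expand[OF alternating_forms_linear[OF separately_alternating_fst[OF \<omega>] that]] by simp
    then show ?thesis by simp
  qed
  finally show ?thesis
    unfolding sum_distrib_left left_diff_distrib by linarith
qed

section \<open>Iterated multiplication and the vanishing of its kernel\<close>

primrec metric_mult_pow :: "nat \<Rightarrow> nat \<Rightarrow> nat \<Rightarrow> 'a::real_inner double_form \<Rightarrow> 'a double_form" where
  "metric_mult_pow 0 p q \<omega> = \<omega>"
| "metric_mult_pow (Suc l) p q \<omega> = metric_mult (l + p) (l + q) (metric_mult_pow l p q \<omega>)"

lemma metric_mult_pow_closed:
  "\<omega> \<in> separately_alternating p q \<Longrightarrow> metric_mult_pow l p q \<omega> \<in> separately_alternating (l + p) (l + q)"
  by (induction l) (auto intro: metric_mult_closed)

lemma metric_mult_pow_add: "metric_mult_pow l p q (\<lambda>x y. c * \<omega> x y + \<eta> x y) =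
    (\<lambda>x y. c * metric_mult_pow l p q \<omega> x y + metric_mult_pow l p q \<eta> x y)"
  by (induction l) (simp_all add: metric_mult_add)

lemma metric_mult_pow_0: "metric_mult_pow l p q (\<lambda>x y. 0) = (\<lambda>x y. 0)"
  by (induction l) (simp_all add: metric_mult_0)

text \<open>Lets \<open>L^m\<close> of \<open>L \<Lambda> \<omega>\<close> be read as
  \<open>L^(m+1)\<close> of \<open>\<Lambda> \<omega>\<close>.\<close>

lemma metric_mult_pow_metric_mult:
  "metric_mult_pow l (Suc p) (Suc q) (metric_mult p q \<omega>) = metric_mult_pow (Suc l) p q \<omega>"
  by (induction l) simp_all

text \<open>
  Keeping \<open>\<kappa>\<close> abstract covers both the case \<open>p = 0 \<or> q = 0\<close>, where \<open>\<kappa> = 0\<close> and the contraction is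
  meaningless on \<open>\<omega>\<close>, and the case of positive bidegree, where \<open>\<kappa>\<close> is \<open>g\<close> times the contraction of \<open>\<omega>\<close>.
\<close>

lemma contraction_metric_mult_pow:
  assumes \<omega>: "\<omega> \<in> separately_alternating p q"
    and unit: "\<And>e. e \<in> E \<Longrightarrow> e \<bullet> e = 1" and basis: "\<And>u. (\<Sum>e\<in>E. (e \<bullet> u) *\<^sub>R e) = u"
    and \<kappa>: "contraction E (metric_mult p q \<omega>) =
      (\<lambda>x y. (of_nat (card E) - of_nat p - of_nat q) * \<omega> x y + \<kappa> x y)"
  shows "contraction E (metric_mult_pow (Suc l) p q \<omega>) =
    (\<lambda>x y. of_nat (Suc l) * (of_nat (card E) - of_nat p - of_nat q - of_nat l) * metric_mult_pow l p q \<omega> x y +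
      metric_mult_pow l p q \<kappa> x y)"
proof (induction l)
  case 0
  show ?case by (simp add: \<kappa>)
next
  case (Suc l)
  let ?\<eta> = "metric_mult_pow (Suc l) p q \<omega>"
  have \<eta>: "?\<eta> \<in> separately_alternating (Suc (l + p)) (Suc (l + q))"
    using metric_mult_pow_closed[OF \<omega>, of "Suc l"] by simp
  \<comment> \<open>\<open>?\<eta>\<close> has positive bidegree even if \<open>\<omega>\<close> has
    not, so the genuine commutator applies to it.\<close>
  have "contraction E (metric_mult_pow (Suc (Suc l)) p q \<omega>) =
      (\<lambda>x y. (of_nat (card E) - of_nat (Suc (l + p)) - of_nat (Suc (l + q))) * ?\<eta> x y +
        metric_mult (l + p) (l + q) (contraction E ?\<eta>) x y)"
    unfolding metric_mult_contraction[OF \<eta>]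
    using contraction_metric_mult[OF \<eta> unit basis] by (simp add: fun_eq_iff)
  \<comment> \<open>With \<open>N = card E - p - q\<close> the coefficients add up as
    \<open>(l+1)(N-l) + N - 2(l+1) = (l+2)(N-l-1)\<close>.\<close>
  also have "\<dots> = (\<lambda>x y. of_nat (Suc (Suc l)) * (of_nat (card E) - of_nat p - of_nat q - of_nat (Suc l)) *
        ?\<eta> x y + metric_mult_pow (Suc l) p q \<kappa> x y)"
    unfolding Suc metric_mult_add by (simp add: fun_eq_iff algebra_simps)
  finally show ?case .
qed

text \<open>Both descents, \<open>(p, q, m+1)\<close> to \<open>(p-1, q-1, m+2)\<close> and to
  \<open>(p, q, m)\<close>, lower the measure \<open>2 * p + l\<close> by one. They also lower
  \<open>p + q + l\<close> by one, so the dimension bound persists.\<close>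

lemma metric_mult_pow_eq_0:
  fixes \<omega> :: "'a::real_inner double_form"
  assumes unit: "\<And>e. e \<in> E \<Longrightarrow> e \<bullet> e = 1" and basis: "\<And>u::'a. (\<Sum>e\<in>E. (e \<bullet> u) *\<^sub>R e) = u"
    and "p + q + l \<le> card E" and "\<omega> \<in> separately_alternating p q"
    and "metric_mult_pow l p q \<omega> = (\<lambda>x y. 0)"
  shows "\<omega> = (\<lambda>x y. 0)"
  using assms(3-5)
proof (induction "2 * p + l" arbitrary: p q l \<omega> rule: less_induct)
  case less
  note \<omega> = less.prems(2)
  show ?case
  proof (cases l)
    case 0
    then show ?thesis using less.prems by simp
  next
    case (Suc m)
    define c :: real where "c = of_nat (Suc m) * (of_nat (card E) - of_nat p - of_nat q - of_nat m)"
    \<comment> \<open>The bound is strict because \<open>l = m + 1\<close>; hence the last factor of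
      \<open>c\<close> is positive.\<close>
    have "real p + real q + real m < real (card E)" using less.prems(1) Suc by linarith
    then have c: "c \<noteq> 0" by (simp add: c_def)
    have zero: "contraction E (metric_mult_pow (Suc m) p q \<omega>) = (\<lambda>x y. 0)"
      using less.prems(3) Suc by (simp add: contraction_def fun_eq_iff)
    have "metric_mult_pow m p q \<omega> = (\<lambda>x y. 0)"
    proof (cases "p = 0 \<or> q = 0")
      case True
      then have "contraction E (metric_mult p q \<omega>) =
          (\<lambda>x y. (of_nat (card E) - of_nat p - of_nat q) * \<omega> x y + 0)"
        using contraction_metric_mult[OF \<omega> unit basis] by (auto simp: fun_eq_iff)
      from contraction_metric_mult_pow[OF \<omega> unit basis this, of m] c zero
      show ?thesis by (simp add: fun_eq_iff metric_mult_pow_0 c_def)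
    next
      case False
      then obtain p' q' where pq: "p = Suc p'" "q = Suc q'"
        using not0_implies_Suc by blast
      note \<omega>' = \<omega>[unfolded pq]
      define \<eta> where "\<eta> = contraction E \<omega>"
      have "contraction E (metric_mult p q \<omega>) = (\<lambda>x y. (of_nat (card E) - of_nat p - of_nat q) * \<omega> x y +
          metric_mult p' q' \<eta> x y)"
        using contraction_metric_mult[OF \<omega>' unit basis] metric_mult_contraction[OF \<omega>', of E]
        by (simp add: fun_eq_iff pq \<eta>_def)
      from contraction_metric_mult_pow[OF \<omega> unit basis this, of m]
      have eq: "(\<lambda>x y. c * metric_mult_pow m p q \<omega> x y + metric_mult_pow (Suc m) p' q' \<eta> x y) = (\<lambda>x y. 0)"
        unfolding zero unfolding pq metric_mult_pow_metric_mult c_def by (rule sym)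
      \<comment> \<open>Multiplying \<open>eq\<close> by the metric turns its first term into
        \<open>c\<close> times the form that vanishes by assumption.\<close>
      have "metric_mult (m + p) (m + q) (metric_mult_pow (Suc m) p' q' \<eta>) = (\<lambda>x y. 0)"
        using arg_cong[OF eq, of "metric_mult (m + p) (m + q)"] less.prems(3)
        unfolding metric_mult_add metric_mult_0 Suc by (simp add: fun_eq_iff)
      then have "metric_mult_pow (Suc (Suc m)) p' q' \<eta> = (\<lambda>x y. 0)"
        by (simp add: pq)
      moreover have "\<eta> \<in> separately_alternating p' q'"
        unfolding \<eta>_def using \<omega>' by (rule contraction_closed)
      moreover have "p' + q' + Suc (Suc m) \<le> card E" "2 * p' + Suc (Suc m) < 2 * p + l"
        using less.prems(1) by (simp_all add: pq Suc)
      ultimately have "\<eta> = (\<lambda>x y. 0)"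
        using less.hyps by blast
      then show ?thesis
        using eq c unfolding \<open>\<eta> = (\<lambda>x y. 0)\<close> metric_mult_pow_0 by (simp add: fun_eq_iff)
    qed
    moreover have "p + q + m \<le> card E" "2 * p + m < 2 * p + l"
      using less.prems(1) by (simp_all add: Suc)
    ultimately show ?thesis
      using less.hyps \<omega> by blast
  qed
qed

section \<open>Powers of the metric and injectivity\<close>

text \<open>Associativity peels one metric factor off the power at a time.\<close>

lemma double_mult_metric_power:
  assumes \<omega>: "\<omega> \<in> separately_alternating p q"
  shows "double_mult l l p q (metric_power l) \<omega> = metric_mult_pow l p q \<omega>"
proof (induction l)
  case 0
  show ?case
  proof (intro ext)
    fix x y
    \<comment> \<open>The constant \<open>1\<close> is a left unit: by alternation all
      \<open>fact p * fact q\<close> signed terms equal \<open>\<omega> x y\<close>, which cancels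
      the normalisation.\<close>
    have 1: "\<omega> (\<lambda>i. x (\<sigma> i)) (\<lambda>i. y (\<tau> i)) = of_int (sign \<sigma>) * of_int (sign \<tau>) * \<omega> x y"
      if "\<sigma> permutes {..<p}" "\<tau> permutes {..<q}" for \<sigma> \<tau>
      using alternating_forms_permute[OF separately_alternating_fst[OF \<omega>] that(1)]
        alternating_forms_permute[OF separately_alternating_snd[OF \<omega>] that(2)]
      by (simp add: comp_def)
    have 2: "of_int (sign \<sigma>) * of_int (sign \<tau>) * (of_int (sign \<sigma>) * of_int (sign \<tau>) * \<omega> x y) = \<omega> x y"
      for \<sigma> \<tau> :: "nat \<Rightarrow> nat"
      by (simp add: sign_def)
    have card: "card {\<sigma>. \<sigma> permutes {..<n::nat}} = fact n" for n
      by (rule card_permutations) auto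
    show "double_mult 0 0 p q (metric_power 0) \<omega> x y = metric_mult_pow 0 p q \<omega> x y"
    proof -
      have "(\<Sum>\<sigma> | \<sigma> permutes {..<p}. \<Sum>\<tau> | \<tau> permutes {..<q}. of_int (sign \<sigma>) * of_int (sign \<tau>) *
          \<omega> (\<lambda>i. x (\<sigma> i)) (\<lambda>i. y (\<tau> i))) =
        (\<Sum>\<sigma> | \<sigma> permutes {..<p}. \<Sum>\<tau> | \<tau> permutes {..<q}. \<omega> x y)"
        by (intro sum.cong refl) (simp only: mem_Collect_eq 1 2)
      then show ?thesis by (simp add: double_mult_def card)
    qed
  qed
next
  case (Suc l)
  have "double_mult (1 + l) (1 + l) p q (double_mult 1 1 l l metric_form (metric_power l)) \<omega> =
      double_mult 1 1 (l + p) (l + q) metric_form (double_mult l l p q (metric_power l) \<omega>)"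
    by (rule double_mult_assoc) (simp add: metric_form_def)
  then show ?case by (simp add: Suc metric_mult_def)
qed

lemma double_forms_separately_alternating: "double_forms p q \<subseteq> separately_alternating p q"
proof
  fix \<omega> :: "'a double_form" assume "\<omega> \<in> double_forms p q"
  then obtain m :: nat and \<alpha> \<beta> where \<omega>: "\<omega> = (\<lambda>x y. \<Sum>k<m. tensor (\<alpha> k) (\<beta> k) x y)"
    and ab: "\<forall>k<m. \<alpha> k \<in> alternating_forms p \<and> \<beta> k \<in> alternating_forms q"
    unfolding double_forms_def by blast
  have "(\<lambda>x. \<Sum>k<m. \<beta> k y * \<alpha> k x) \<in> alternating_forms p" for y
    using ab by (intro alternating_forms_sum) auto
  moreover have "(\<lambda>y. \<Sum>k<m. \<alpha> k x * \<beta> k y) \<in> alternating_forms q" for x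
    using ab by (intro alternating_forms_sum) auto
  ultimately show "\<omega> \<in> separately_alternating p q"
    unfolding separately_alternating_def \<omega> tensor_def by (simp add: mult.commute)
qed

theorem proposition2p3:
  fixes n p q l :: nat
  assumes "\<exists>B::'a::real_inner set. finite B \<and> span B = UNIV"
    and "dim (UNIV :: 'a set) = n"
    and "p + q + l < n + 1"
  shows "(\<lambda>\<omega> :: 'a double_form. double_mult l l p q (metric_power l) \<omega>)
           \<in> double_forms p q \<rightarrow> double_forms (p + l) (q + l) \<and>
         inj_on (\<lambda>\<omega> :: 'a double_form. double_mult l l p q (metric_power l) \<omega>)
           (double_forms p q)"
proof
  show "(\<lambda>\<omega> :: 'a double_form. double_mult l l p q (metric_power l) \<omega>)
      \<in> double_forms p q \<rightarrow> double_forms (p + l) (q + l)"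
    using assms(1) metric_power_mult_closed by blast
  obtain B :: "'a set" where B: "finite B" "span B = UNIV"
    using assms(1) by blast
  obtain E :: "'a set" where E: "finite E" "card E = dim (UNIV :: 'a set)"
    "\<And>e. e \<in> E \<Longrightarrow> e \<bullet> e = 1" "\<And>u. (\<Sum>e\<in>E. (e \<bullet> u) *\<^sub>R e) = u"
    by (rule orthonormal_basis_exists[OF B]) blast
  show "inj_on (\<lambda>\<omega> :: 'a double_form. double_mult l l p q (metric_power l) \<omega>) (double_forms p q)"
  proof
    fix \<omega> \<eta> :: "'a double_form"
    assume "\<omega> \<in> double_forms p q" "\<eta> \<in> double_forms p q"
    then have mem: "\<omega> \<in> separately_alternating p q" "\<eta> \<in> separately_alternating p q"
      using double_forms_separately_alternating by auto
    assume "double_mult l l p q (metric_power l) \<omega> = double_mult l l p q (metric_power l) \<eta>"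
    \<comment> \<open>By linearity the difference lies in the kernel; it is written in the shape
      \<open>c * \<eta> + \<omega>\<close> of \<open>metric_mult_pow_add\<close>.\<close>
    then have zero: "metric_mult_pow l p q (\<lambda>x y. -1 * \<eta> x y + \<omega> x y) = (\<lambda>x y. 0)"
      unfolding metric_mult_pow_add using mem by (simp add: double_mult_metric_power)
    have diff: "(\<lambda>x y. -1 * \<eta> x y + \<omega> x y) \<in> separately_alternating p q"
    proof -
      \<comment> \<open>The difference as a sum over two indices, to fit
        \<open>separately_alternating_sum\<close>.\<close>
      have "(\<lambda>x y. \<Sum>k\<in>{True, False}. (if k then -1 else 1) * (if k then \<eta> else \<omega>) x y) \<in>
          separately_alternating p q"
        using mem by (intro separately_alternating_sum) auto
      then show ?thesis by simp
    qed
    have "p + q + l \<le> card E"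
      using E(2) assms(2,3) by simp
    from metric_mult_pow_eq_0[OF E(3,4) this diff zero]
    have "(\<lambda>x y. -1 * \<eta> x y + \<omega> x y) = (\<lambda>x y. 0)" .
    then show "\<omega> = \<eta>" by (simp add: fun_eq_iff)
  qed
qed

end
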